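(* Let $M\in\mathbb{R}^{n\times n}$ be symmetric positive semidefinite with eigenvalue decomposition $M=Q\Lambda Q^\top$, where $Q$ is orthogonal, $\Lambda=\mathrm{diag}(\lambda_1,\dots,\lambda_n)$ and $\lambda_1\ge\dots\ge\lambda_n\ge0$. Then for any rank-$k$ orthogonal projector $P\in\mathbb{R}^{n\times n}$, $$\|M-MP\|_F^2=\sum_{i=1}^n\lambda_i^2\,\bigl\|(I-P)q_i\bigr\|_2^2,$$ where $q_i$ is the $i$-th column of $Q$.
   Context: $\|\cdot\|_F$ is the Frobenius norm and $\|\cdot\|_2$ the Euclidean norm of vectors. An orthogonal projector is a matrix with $P^\top=P=P^2$. *)

theory Defs
  imports "HOL-Analysis.Analysis"
begin

text \<open>
  Matrices in $\mathbb{R}^{n \times n}$ are rendered over an index type of class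
  \<open>{finite, linorder}\<close>. The linear order plays the role of the order
  $1 < \dots < n$ of the indices, so that a decreasing enumeration
  $\lambda_1 \ge \dots \ge \lambda_n$ is an antitone function on the index type.
\<close>

definition frobenius_norm :: "real^'n^'m \<Rightarrow> real" where
  "frobenius_norm A = sqrt (\<Sum>i\<in>UNIV. \<Sum>j\<in>UNIV. (A $ i $ j)\<^sup>2)"

definition diag_matrix :: "('n \<Rightarrow> real) \<Rightarrow> real^'n^'n" where
  "diag_matrix d = (\<chi> i j. if i = j then d i else 0)"

definition psd_matrix :: "real^'n^'n \<Rightarrow> bool" where
  "psd_matrix A \<longleftrightarrow> transpose A = A \<and> (\<forall>x. 0 \<le> x \<bullet> (A *v x))"

definition orthogonal_projector :: "real^'n^'n \<Rightarrow> bool" where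
  "orthogonal_projector P \<longleftrightarrow> transpose P = P \<and> P ** P = P"

end

theory Submission
  imports Defs
begin

text \<open>
  Since \<open>M - M P = Q \<Lambda> Q\<^sup>T (I - P)\<close> and the Frobenius norm is invariant under left
  multiplication by \<open>Q\<close>, it suffices to compute the norm of \<open>\<Lambda> Q\<^sup>T (I - P)\<close> row by row:
  as \<open>I - P\<close> is symmetric, row \<open>i\<close> is \<open>\<lambda>\<^sub>i (I - P) q\<^sub>i\<close>.
\<close>

lemma frobenius_norm_power2_eq_rows:
  fixes A :: "real^'n^'m"
  shows "(frobenius_norm A)\<^sup>2 = (\<Sum>i\<in>UNIV. (norm (row i A))\<^sup>2)"
  by (simp add: frobenius_norm_def norm_vec_def L2_set_def row_def sum_nonneg)

lemma frobenius_norm_transpose: "frobenius_norm (transpose A) = frobenius_norm A"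
  unfolding frobenius_norm_def transpose_def by (subst sum.swap) simp

text \<open>Columns of \<open>A\<close> are rows of its transpose, which has the same norm. This
  form suits left multiplication, which acts on each column separately.\<close>

lemma frobenius_norm_power2_eq_columns:
  fixes A :: "real^'n^'m"
  shows "(frobenius_norm A)\<^sup>2 = (\<Sum>j\<in>UNIV. (norm (column j A))\<^sup>2)"
  using frobenius_norm_power2_eq_rows[of "transpose A"] by (simp add: frobenius_norm_transpose)

lemma norm_orthogonal_matrix_mult:
  fixes Q :: "real^'n^'n"
  assumes "orthogonal_matrix Q"
  shows "norm (Q *v x) = norm x"
proof -
  have "orthogonal_transformation ((*v) Q)"
    using assms by (simp add: orthogonal_transformation_matrix)
  then show ?thesis
    by (rule orthogonal_transformation_norm)
qed

lemma column_matrix_mult: "column j (A ** B) = A *v column j B"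
  by (simp add: vec_eq_iff column_def matrix_matrix_mult_def matrix_vector_mult_def)

lemma matrix_mult_diff_distrib:
  fixes A :: "real^'n^'m" and B C :: "real^'p^'n"
  shows "A ** (B - C) = A ** B - A ** C"
  by (simp add: vec_eq_iff matrix_matrix_mult_def right_diff_distrib sum_subtractf)

lemma row_diag_matrix_mult: "row i (diag_matrix d ** A) = d i *\<^sub>R row i A"
  by (simp add: vec_eq_iff row_def matrix_matrix_mult_def diag_matrix_def if_distrib if_distribR
      cong: if_cong)

text \<open>Turns the rows of \<open>transpose Q ** B\<close> into images of the columns of
  \<open>Q\<close>, at the cost of a transpose on \<open>B\<close>.\<close>

lemma row_transpose_mult:
  fixes A :: "real^'n^'m" and B :: "real^'p^'m"
  shows "row i (transpose A ** B) = transpose B *v column i A"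
  by (simp add: vec_eq_iff row_def column_def transpose_def matrix_matrix_mult_def
      matrix_vector_mult_def mult.commute)

text \<open>Each column of \<open>A\<close> is mapped by the isometry \<open>Q\<close>, so its
  Euclidean norm is unchanged.\<close>

lemma frobenius_norm_power2_orthogonal_mult:
  fixes Q :: "real^'m^'m" and A :: "real^'n^'m"
  assumes "orthogonal_matrix Q"
  shows "(frobenius_norm (Q ** A))\<^sup>2 = (frobenius_norm A)\<^sup>2"
  by (simp add: frobenius_norm_power2_eq_columns column_matrix_mult
      norm_orthogonal_matrix_mult[OF assms])

theorem theorem3p3:
  fixes M Q P :: "real^('n::{finite,linorder})^('n::{finite,linorder})"
    and lam :: "'n \<Rightarrow> real"
    and k :: nat
  assumes "psd_matrix M"
    and "orthogonal_matrix Q"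
    and "M = Q ** diag_matrix lam ** transpose Q"
    and "\<And>i j. i \<le> j \<Longrightarrow> lam j \<le> lam i"
    and "\<And>i. 0 \<le> lam i"
    and "orthogonal_projector P"
    and "rank P = k"
  shows "(frobenius_norm (M - M ** P))\<^sup>2 =
    (\<Sum>i\<in>UNIV. (lam i)\<^sup>2 * (norm ((mat 1 - P) *v column i Q))\<^sup>2)"
proof -
  have "transpose P = P"
    using assms(6) by (simp add: orthogonal_projector_def)
  \<comment> \<open>Symmetry of \<open>P\<close> removes the transpose that
    \<open>row_transpose_mult\<close> introduces.\<close>
  then have S: "transpose (mat 1 - P) = mat 1 - P"
    by (simp add: vec_eq_iff transpose_def mat_def)
  \<comment> \<open>Bracketed to the right so that \<open>Q\<close> is the outermost factor and can
    be cancelled in the norm.\<close>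
  have "M - M ** P = Q ** (diag_matrix lam ** (transpose Q ** (mat 1 - P)))"
    by (simp add: assms(3) matrix_mult_diff_distrib matrix_mul_assoc)
  then have "(frobenius_norm (M - M ** P))\<^sup>2 =
      (frobenius_norm (diag_matrix lam ** (transpose Q ** (mat 1 - P))))\<^sup>2"
    by (simp only: frobenius_norm_power2_orthogonal_mult[OF assms(2)])
  also have "\<dots> = (\<Sum>i\<in>UNIV. (norm (lam i *\<^sub>R ((mat 1 - P) *v column i Q)))\<^sup>2)"
    by (simp only: frobenius_norm_power2_eq_rows row_diag_matrix_mult row_transpose_mult S)
  \<comment> \<open>The scalar leaves the norm as \<open>\<bar>lam i\<bar>\<close>, and squaring
    removes the absolute value.\<close>
  finally show ?thesis
    by (simp add: power_mult_distrib)
qed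

end
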